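(* Let $0<q<\infty$, $0<\eta\le1$ and $f\in C_c^\eta(\mathbb{R}^n)$. Then, for every $x\in\mathbb{R}^n$, $$\lim_{s\to0^+}(qs)^{1/q}\mathcal D_{s,q}f(x)=|\mathbb S^{n-1}|^{1/q}|f(x)|.$$
   Context: For $0<s<1$, $\mathcal D_{s,q}f(x):=\left(\int_{\mathbb{R}^n}\frac{|f(x)-f(y)|^q}{|x-y|^{n+sq}}\,dy\right)^{1/q}$. $C_c^\eta(\mathbb{R}^n)$ is the space of compactly supported functions that are Hölder continuous of exponent $\eta$ (Lipschitz if $\eta=1$). $|\mathbb S^{n-1}|$ is the surface measure of the unit sphere. *)

theory Defs
  imports "HOL-Analysis.Analysis"
begin

(* x \<mapsto> x^a on [0, \<infinity>] for an exponent a > 0; in particular \<infinity>^a = \<infinity>. *)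
definition epowr :: "ennreal \<Rightarrow> real \<Rightarrow> ennreal" where
  "epowr t a = (if t = \<infinity> then \<infinity> else ennreal (enn2real t powr a))"

(* The functional takes values in [0, \<infinity>], so no integrability is presupposed.
   At y = x the integrand is 0 / 0 = 0, which only concerns a null set. *)
definition frac_D :: "real \<Rightarrow> real \<Rightarrow> (real^'n \<Rightarrow> 'b::real_normed_field) \<Rightarrow> real^'n \<Rightarrow> ennreal" where
  "frac_D s q f x =
     epowr (\<integral>\<^sup>+ y. ennreal (norm (f x - f y) powr q / norm (x - y) powr (real CARD('n) + s * q)) \<partial>lborel)
       (1 / q)"

definition holder_continuous :: "real \<Rightarrow> ('a::metric_space \<Rightarrow> 'b::metric_space) \<Rightarrow> bool" where
  "holder_continuous \<eta> f \<longleftrightarrow> (\<exists>C. \<forall>x y. dist (f x) (f y) \<le> C * dist x y powr \<eta>)"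

definition holder_c :: "real \<Rightarrow> (real^'n \<Rightarrow> 'b::real_normed_field) set" where
  "holder_c \<eta> = {f. holder_continuous \<eta> f \<and> compact (closure (support_on UNIV f))}"

(* The (n-1)-dimensional surface measure on the unit sphere, as in integration in polar coordinates:
   a Borel set A of the sphere has measure n times the volume of the cone {r u | 0 < r \<le> 1, u \<in> A}.
   In dimension 1 this is the counting measure on {-1, 1}.  Note sgn x = x / |x|. *)
definition sphere_measure :: "'a::euclidean_space measure" where
  "sphere_measure =
     scale_measure (of_nat DIM('a))
       (distr (restrict_space lborel (cball 0 1 - {0})) (restrict_space borel (sphere 0 1)) sgn)"

lemma sgn_measurable_sphere:
  "sgn \<in> restrict_space lborel (cball 0 1 - {0 :: 'a :: euclidean_space}) \<rightarrow>\<^sub>M restrict_space borel (sphere 0 1)"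
proof (rule measurable_restrict_space2)
  show "sgn \<in> space (restrict_space lborel (cball 0 1 - {0::'a})) \<rightarrow> sphere 0 1"
    by (auto simp: space_restrict_space norm_sgn)
  have "(sgn :: 'a \<Rightarrow> 'a) \<in> borel_measurable borel"
    unfolding sgn_div_norm[abs_def] by measurable
  then show "sgn \<in> restrict_space lborel (cball 0 1 - {0::'a}) \<rightarrow>\<^sub>M borel"
    by (intro measurable_restrict_space1) simp
qed

lemma emeasure_sphere_measure:
  fixes A :: "'a::euclidean_space set"
  assumes "A \<in> sets borel" "A \<subseteq> sphere 0 1"
  shows "emeasure sphere_measure A = of_nat DIM('a) * emeasure lborel {r *\<^sub>R u |r u. 0 < r \<and> r \<le> 1 \<and> u \<in> A}"
proof -
  have A: "A \<in> sets (restrict_space borel (sphere 0 1))"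
    using assms by (auto simp: sets_restrict_space)
  have "sgn -` A \<inter> space (restrict_space lborel (cball 0 1 - {0::'a})) =
        {r *\<^sub>R u |r u. 0 < r \<and> r \<le> 1 \<and> u \<in> A}" (is "?L = ?R")
  proof (intro equalityI subsetI)
    fix x assume "x \<in> ?L"
    then have "sgn x \<in> A" "norm x \<le> 1" "x \<noteq> 0" "x = norm x *\<^sub>R sgn x"
      by (auto simp: space_restrict_space sgn_div_norm)
    then show "x \<in> ?R"
      by (intro CollectI exI[of _ "norm x"] exI[of _ "sgn x"]) auto
  next
    fix x assume "x \<in> ?R"
    then obtain r u where x: "x = r *\<^sub>R u" "0 < r" "r \<le> 1" "u \<in> A" by auto
    then have "norm u = 1" using assms by auto
    then show "x \<in> ?L" using x by (auto simp: space_restrict_space sgn_div_norm)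
  qed
  moreover have "?R \<subseteq> cball 0 1 - {0}"
    using assms by force
  ultimately show ?thesis
    by (simp add: sphere_measure_def emeasure_distr[OF sgn_measurable_sphere A] emeasure_restrict_space)
qed

lemma measure_sphere_measure:
  "measure (sphere_measure :: 'a::euclidean_space measure) (sphere 0 1) = real DIM('a) * unit_ball_vol (real DIM('a))"
proof -
  have "{r *\<^sub>R u |r u. 0 < r \<and> r \<le> 1 \<and> u \<in> sphere 0 1} = cball 0 1 - {0::'a}" (is "?L = ?R")
  proof (intro equalityI subsetI)
    fix x assume "x \<in> ?R"
    then show "x \<in> ?L"
      by (intro CollectI exI[of _ "norm x"] exI[of _ "sgn x"]) (auto simp: sgn_div_norm)
  qed auto
  moreover have "emeasure lborel (cball 0 1 - {0::'a}) = ennreal (unit_ball_vol (real DIM('a)))"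
    by (subst emeasure_Diff) (auto simp: emeasure_cball)
  ultimately have "emeasure (sphere_measure :: 'a measure) (sphere 0 1) =
      ennreal (real DIM('a) * unit_ball_vol (real DIM('a)))"
    by (subst emeasure_sphere_measure) (auto simp: ennreal_mult ennreal_of_nat_eq_real_of_nat)
  then show ?thesis
    by (simp add: measure_def)
qed

end

(* Fix x and a radius R >= 1 such that f vanishes outside the ball of radius R around x.  In polar
   coordinates the part of the integral over |x - y| >= R equals exactly
   |f x|^q |S^(n-1)| R^(-s q) / (s q), whereas for s < eta / 2 the Hoelder condition bounds the
   remaining part independently of s.  After multiplication by q s only the former survives as s
   tends to 0. *)
theory Submission
  imports Defs
begin

text \<open>Polar coordinates for radial functions. Half-lines \<open>{..a}\<close> generate the
  Borel sets and have finite mass, so comparing them suffices: one side is the volume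
  \<open>?V * a ^ ?n\<close> of a ball, the other the integral of the derivative of
  \<open>?V * r ^ ?n\<close>.\<close>

lemma distr_dist_lborel:
  fixes x :: "'a::euclidean_space"
  shows "distr lborel borel (dist x) =
    density lborel (\<lambda>r. ennreal (DIM('a) * unit_ball_vol DIM('a) * r ^ (DIM('a) - 1)) * indicator {0..} r)"
    (is "?M = ?N")
proof (rule measure_eqI_generator_eq[where E = "range (\<lambda>a::real. {..a})" and \<Omega> = UNIV
        and A = "\<lambda>i. {..real i}"])
  let ?n = "DIM('a)" and ?V = "unit_ball_vol (real DIM('a))"
  show "Int_stable (range (\<lambda>a::real. {..a}))"
    by (auto simp: Int_stable_def)
  show "sets ?M = sigma_sets UNIV (range (\<lambda>a::real. {..a}))"
    "sets ?N = sigma_sets UNIV (range (\<lambda>a::real. {..a}))"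
    by (simp_all add: borel_eq_atMost)
  have M: "emeasure ?M {..a} = emeasure lborel (cball x a)" for a
    by (subst emeasure_distr) (auto intro!: arg_cong[where f = "emeasure lborel"])
  show "emeasure ?M {..real i} \<noteq> \<infinity>" for i
    using emeasure_lborel_cball_finite[of x "real i"] by (simp add: M)
  show "(\<Union>i. {..real i}) = UNIV"
    by (auto intro: real_arch_simple)
  show "emeasure ?M X = emeasure ?N X" if "X \<in> range (\<lambda>a::real. {..a})" for X
  proof -
    obtain a where X: "X = {..a}" using \<open>X \<in> _\<close> by auto
    have N: "emeasure ?N X = (\<integral>\<^sup>+r. ennreal (?n * ?V * r ^ (?n - 1)) * indicator {0..a} r \<partial>lborel)"
      unfolding X
      by (subst emeasure_density) (auto intro!: nn_integral_cong split: split_indicator)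
    show ?thesis
    proof (cases "0 \<le> a")
      case True
      \<comment> \<open>The subtracted term is the antiderivative at the left endpoint; it vanishes
        because the dimension is positive.\<close>
      have "emeasure ?N X = ?V * a ^ ?n - ?V * 0 ^ ?n"
        unfolding N
      proof (rule nn_integral_FTC_Icc)
        show "((\<lambda>r. ?V * r ^ ?n) has_real_derivative ?n * ?V * r ^ (?n - 1)) (at r)" for r
          by (auto intro!: derivative_eq_intros)
      qed (use True in auto)
      then show ?thesis
        using True by (simp add: X M emeasure_cball)
    next
      case False
      then have "emeasure ?N X = 0"
        unfolding N by simp
      then show ?thesis
        unfolding X M using False by simp
    qed
  qed
qed auto

lemma nn_integral_dist:
  fixes x :: "'a::euclidean_space" and h :: "real \<Rightarrow> ennreal"
  assumes [measurable]: "h \<in> borel_measurable borel"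
  shows "(\<integral>\<^sup>+y. h (dist x y) \<partial>lborel) =
    (\<integral>\<^sup>+r. ennreal (DIM('a) * unit_ball_vol DIM('a) * r ^ (DIM('a) - 1)) * indicator {0..} r * h r \<partial>lborel)"
proof -
  have "(\<integral>\<^sup>+y. h (dist x y) \<partial>lborel) = integral\<^sup>N (distr lborel borel (dist x)) h"
    by (subst nn_integral_distr) auto
  then show ?thesis
    unfolding distr_dist_lborel by (simp add: nn_integral_density)
qed

text \<open>The Jacobian \<open>r ^ (n - 1)\<close> turns the exponent \<open>a - n\<close> into
  \<open>a - 1\<close>, leaving a one-dimensional integral. It serves twice: with
  \<open>a = - s * q\<close> on \<open>{R..}\<close> and with \<open>a = c\<close> on
  \<open>{0..R}\<close>.\<close>

lemma nn_integral_dist_powr: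
  fixes x :: "'a::euclidean_space"
  assumes A: "A \<in> sets borel" "A \<subseteq> {0..}"
    and I: "((\<lambda>r. r powr (a - 1)) has_integral I) A"
  shows "(\<integral>\<^sup>+y. ennreal (dist x y powr (a - real DIM('a))) * indicator A (dist x y) \<partial>lborel) =
    ennreal (DIM('a) * unit_ball_vol DIM('a) * I)"
proof -
  let ?n = "DIM('a)" and ?V = "unit_ball_vol (real DIM('a))"
  note [measurable] = A(1)
  have "(\<integral>\<^sup>+y. ennreal (dist x y powr (a - real ?n)) * indicator A (dist x y) \<partial>lborel) =
    (\<integral>\<^sup>+r. ennreal (?n * ?V * r ^ (?n - 1)) * indicator {0..} r *
        (ennreal (r powr (a - real ?n)) * indicator A r) \<partial>lborel)"
    by (rule nn_integral_dist) measurable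
  also have "\<dots> = (\<integral>\<^sup>+r. ennreal (?n * ?V) * (ennreal (r powr (a - 1)) * indicator A r) \<partial>lborel)"
  \<comment> \<open>Discarding the null set \<open>r = 0\<close> leaves \<open>r > 0\<close> on
    \<open>A\<close>, where natural and real powers can be merged.\<close>
  proof (rule nn_integral_cong_AE, rule AE_mp[OF AE_lborel_singleton[of 0]], intro AE_I2 impI)
    fix r :: real assume "r \<noteq> 0"
    have powr: "r ^ (?n - 1) * r powr (a - real ?n) = r powr (a - 1)" if "r > 0"
    proof -
      have "r ^ (?n - 1) = r powr (real ?n - 1)"
        using that DIM_positive[where 'a='a] by (simp add: powr_realpow[symmetric] of_nat_diff Suc_leI)
      then show ?thesis by (simp add: powr_add[symmetric])
    qed
    show "ennreal (?n * ?V * r ^ (?n - 1)) * indicator {0..} r *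
        (ennreal (r powr (a - real ?n)) * indicator A r) =
        ennreal (?n * ?V) * (ennreal (r powr (a - 1)) * indicator A r)"
    proof (cases "r \<in> A")
      case True
      then have "r > 0" using A(2) \<open>r \<noteq> 0\<close> by force
      then show ?thesis
        using True powr by (simp add: ennreal_mult[symmetric] mult.assoc)
    qed simp
  qed
  also have "\<dots> = ennreal (?n * ?V) * (\<integral>\<^sup>+r. ennreal (r powr (a - 1)) * indicator A r \<partial>lborel)"
    by (rule nn_integral_cmult) measurable
  also have "(\<integral>\<^sup>+r. ennreal (r powr (a - 1)) * indicator A r \<partial>lborel) =
      (\<integral>\<^sup>+r. ennreal (indicator A r * r powr (a - 1)) \<partial>lborel)"
    by (intro nn_integral_cong) (auto split: split_indicator)
  also have "\<dots> = ennreal I"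
    by (rule nn_integral_has_integral_lebesgue[OF _ I]) simp
  also have "ennreal (?n * ?V) * ennreal I = ennreal (?n * ?V * I)"
    using has_integral_nonneg[OF I] by (simp add: ennreal_mult)
  finally show ?thesis .
qed

lemma epowr_ennreal: "0 \<le> u \<Longrightarrow> epowr (ennreal u) a = ennreal (u powr a)"
  by (simp add: epowr_def)

lemma epowr_mono:
  assumes "0 \<le> a" "t \<le> u"
  shows "epowr t a \<le> epowr u a"
proof (cases "u = \<infinity>")
  case False
  then have "t \<noteq> \<infinity>" using assms(2) by (auto simp: top_unique)
  with False assms show ?thesis
    by (auto simp: epowr_def less_top intro!: ennreal_leI powr_mono2 enn2real_mono)
qed (simp add: epowr_def)

theorem theorem3p3:
  fixes q \<eta> :: real and f :: "real^'n \<Rightarrow> 'b::real_normed_field" and x :: "real^'n"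
  assumes "0 < q" and "0 < \<eta>" "\<eta> \<le> 1" and "f \<in> holder_c \<eta>"
  shows "((\<lambda>s. ennreal ((q * s) powr (1 / q)) * frac_D s q f x) \<longlongrightarrow>
           ennreal (measure (sphere_measure :: (real^'n) measure) (sphere 0 1) powr (1 / q) * norm (f x)))
         (at_right 0)"
proof -
  let ?n = "real CARD('n)"
  define \<sigma> where "\<sigma> = measure (sphere_measure :: (real^'n) measure) (sphere 0 1)"
  have \<sigma>: "\<sigma> = real DIM(real^'n) * unit_ball_vol (real DIM(real^'n))"
    by (simp add: \<sigma>_def measure_sphere_measure)
  then have "\<sigma> \<ge> 0" by simp
  define A where "A = norm (f x) powr q"
  have "A \<ge> 0" by (simp add: A_def)
  have holder: "holder_continuous \<eta> f"
    and supp: "bounded {y. f y \<noteq> 0}"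
    using assms(4) by (auto simp: holder_c_def support_on_def compact_eq_bounded_closed
        intro: bounded_subset[OF _ closure_subset])
  obtain C0 where C0: "\<And>y z. dist (f y) (f z) \<le> C0 * dist y z powr \<eta>"
    using holder unfolding holder_continuous_def by blast
  \<comment> \<open>Truncation makes nonnegativity immediate, as needed to distribute
    \<open>powr q\<close> over the product in the Hoelder bound.\<close>
  define C where "C = max C0 0"
  have "C \<ge> 0" by (simp add: C_def)
  have C: "norm (f x - f y) \<le> C * dist x y powr \<eta>" for y
    using C0[of x y] mult_right_mono[of C0 C "dist x y powr \<eta>"] by (simp add: C_def dist_norm)
  obtain R0 where R0: "\<And>y. f y \<noteq> 0 \<Longrightarrow> dist x y \<le> R0"
    using bounded_any_center[THEN iffD1, OF supp, of x] by auto
  \<comment> \<open>The \<open>+ 1\<close> makes \<open>f\<close> vanish already at distance exactly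
    \<open>R\<close>, matching the closed range \<open>{R..}\<close>. The bound
    \<open>R \<ge> 1\<close> makes \<open>R powr t\<close> increasing in \<open>t\<close>.\<close>
  define R where "R = max 1 (R0 + 1)"
  have "R \<ge> 1" by (simp add: R_def)
  have R: "f y = 0" if "R \<le> dist x y" for y
    using R0[of y] that by (fastforce simp: R_def)
  \<comment> \<open>Half of the order of vanishing \<open>\<eta> * q\<close> of the numerator at
    \<open>x\<close>. For \<open>s < \<eta> / 2\<close> the kernel consumes at most the other half,
    since then \<open>s * q \<le> c\<close>.\<close>
  define c where "c = \<eta> * q / 2"
  have "c > 0" using assms by (simp add: c_def)
  define K where "K = C powr q * R powr c"
  have "K \<ge> 0" by (simp add: K_def)
  define G where "G s y = norm (f x - f y) powr q / norm (x - y) powr (?n + s * q)" for s y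
  define J where "J s = (\<integral>\<^sup>+y. ennreal (G s y) \<partial>lborel)" for s
  \<comment> \<open>\<open>far\<close> carries the whole dependence on \<open>s\<close>, while
    \<open>near\<close> is free of it. They overlap on the sphere of radius \<open>R\<close>, which
    is harmless since their sum serves only as an upper bound.\<close>
  define far where "far s y = ennreal (dist x y powr (- s * q - real DIM(real^'n))) * indicator {R..} (dist x y)" for s y
  define near where "near y = ennreal (dist x y powr (c - real DIM(real^'n))) * indicator {0..R} (dist x y)" for y
  have [measurable]: "far s \<in> borel_measurable borel" "near \<in> borel_measurable borel" for s
    unfolding far_def near_def by measurable
  have far: "(\<integral>\<^sup>+y. far s y \<partial>lborel) = ennreal (\<sigma> * (R powr (- s * q) / (s * q)))" if "s > 0" for s
    unfolding far_def \<sigma>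
  proof (rule nn_integral_dist_powr)
    have "s * q > 0" using that assms by simp
    then show "((\<lambda>r. r powr (- s * q - 1)) has_integral R powr (- s * q) / (s * q)) {R..}"
      using has_integral_powr_to_inf[of "- s * q - 1" R] \<open>R \<ge> 1\<close> by simp
  qed (use \<open>R \<ge> 1\<close> in auto)
  have near: "(\<integral>\<^sup>+y. near y \<partial>lborel) = ennreal (\<sigma> * (R powr c / c))"
    unfolding near_def \<sigma>
  proof (rule nn_integral_dist_powr)
    show "((\<lambda>r. r powr (c - 1)) has_integral R powr c / c) {0..R}"
      using has_integral_powr_from_0[of "c - 1" R] \<open>R \<ge> 1\<close> \<open>c > 0\<close> by simp
  qed (use \<open>R \<ge> 1\<close> in auto)
  \<comment> \<open>Here \<open>f y = 0\<close>, so the numerator is the constant \<open>A\<close>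
    and equality holds.\<close>
  have G_far: "ennreal (G s y) = ennreal A * far s y" if "R \<le> dist x y" for s y
    using R[OF that] that
    by (simp add: G_def far_def A_def dist_norm ennreal_mult[symmetric] powr_minus_divide[symmetric] algebra_simps)
       (simp add: powr_diff powr_minus field_simps powr_add)
  have G_near: "ennreal (G s y) \<le> ennreal K * near y"
    if "dist x y \<le> R" "0 < s" "s < \<eta> / 2" for s y
  proof (cases "y = x")
    case True
    then show ?thesis by (simp add: G_def assms)
  next
    case False
    let ?d = "dist x y"
    have d: "?d > 0" using False by simp
    have sq: "0 \<le> s * q" "s * q \<le> c"
      using that assms mult_right_mono[of s "\<eta> / 2" q] by (auto simp: c_def)
    have "norm (f x - f y) powr q \<le> (C * ?d powr \<eta>) powr q"
      using C assms by (intro powr_mono2) auto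
    also have "\<dots> = C powr q * ?d powr (2 * c)"
      using \<open>C \<ge> 0\<close> by (simp add: powr_mult powr_powr c_def)
    finally have "G s y \<le> C powr q * ?d powr (2 * c) / ?d powr (?n + s * q)"
      unfolding G_def dist_norm by (intro divide_right_mono) auto
    \<comment> \<open>The exponent \<open>2 * c - (n + s * q)\<close> is split so that the first
      power is bounded by \<open>R powr c\<close> and the second is integrable near
      \<open>x\<close>, uniformly in \<open>s\<close>.\<close>
    also have "\<dots> = C powr q * ?d powr (c - s * q) * ?d powr (c - ?n)"
      using d by (simp add: powr_diff[symmetric] powr_add[symmetric] algebra_simps flip: times_divide_eq_right)
    also have "\<dots> \<le> C powr q * R powr c * ?d powr (c - ?n)"
    proof (intro mult_right_mono mult_left_mono)
      have "?d powr (c - s * q) \<le> R powr (c - s * q)"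
        using sq that by (intro powr_mono2) auto
      also have "\<dots> \<le> R powr c"
        using sq \<open>R \<ge> 1\<close> by (intro powr_mono) auto
      finally show "?d powr (c - s * q) \<le> R powr c" .
    qed auto
    finally show ?thesis
      using that by (simp add: near_def K_def ennreal_mult[symmetric] ennreal_leI)
  qed
  \<comment> \<open>Obtained by dropping the part of the integral with
    \<open>dist x y < R\<close>.\<close>
  have lower: "ennreal (A * (\<sigma> * (R powr (- s * q) / (s * q)))) \<le> J s" if "0 < s" for s
  proof -
    have "ennreal A * far s y \<le> ennreal (G s y)" for y
    proof (cases "R \<le> dist x y")
      case False
      then show ?thesis by (simp add: far_def)
    qed (simp add: G_far)
    then have "(\<integral>\<^sup>+y. ennreal A * far s y \<partial>lborel) \<le> J s"
      unfolding J_def by (intro nn_integral_mono)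
    then have "ennreal A * ennreal (\<sigma> * (R powr (- s * q) / (s * q))) \<le> J s"
      by (subst (asm) nn_integral_cmult) (simp_all only: far[OF that], measurable)
    then show ?thesis
      by (simp only: ennreal_mult'[OF \<open>A \<ge> 0\<close>])
  qed
  have upper: "J s \<le> ennreal (K * (\<sigma> * (R powr c / c)) + A * (\<sigma> * (R powr (- s * q) / (s * q))))"
    if "0 < s" "s < \<eta> / 2" for s
  proof -
    have "ennreal (G s y) \<le> ennreal K * near y + ennreal A * far s y" for y
    proof (cases "R \<le> dist x y")
      case False
      then show ?thesis using G_near[of y s] that by (simp add: add_increasing2)
    qed (simp add: G_far)
    then have "J s \<le> (\<integral>\<^sup>+y. ennreal K * near y + ennreal A * far s y \<partial>lborel)"
      unfolding J_def by (intro nn_integral_mono)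
    also have "\<dots> = ennreal K * (\<integral>\<^sup>+y. near y \<partial>lborel) + ennreal A * (\<integral>\<^sup>+y. far s y \<partial>lborel)"
      by (simp add: nn_integral_add nn_integral_cmult)
    finally show ?thesis
      using that \<open>A \<ge> 0\<close> \<open>K \<ge> 0\<close> \<open>\<sigma> \<ge> 0\<close> \<open>c > 0\<close> assms
      by (simp add: near far ennreal_mult[symmetric] ennreal_plus[symmetric] del: ennreal_plus)
  qed
  \<comment> \<open>Pulling the prefactor inside the power turns both bounds into powers of real
    numbers, whose limits are elementary.\<close>
  have scale: "ennreal ((q * s) powr (1 / q)) * epowr (ennreal u) (1 / q) = ennreal ((q * s * u) powr (1 / q))"
    if "0 < s" "0 \<le> u" for s u
    using that assms by (simp add: epowr_ennreal ennreal_mult[symmetric] powr_mult)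
  have frac_D: "frac_D s q f x = epowr (J s) (1 / q)" for s
    by (simp add: frac_D_def J_def G_def)
  have lim_R: "((\<lambda>s. R powr (- s * q)) \<longlongrightarrow> 1) (at_right 0)"
  proof -
    have "((\<lambda>s. R powr (- s * q)) \<longlongrightarrow> R powr (- 0 * q)) (at_right 0)"
      using \<open>R \<ge> 1\<close> by (intro tendsto_intros) auto
    then show ?thesis using \<open>R \<ge> 1\<close> by simp
  qed
  have target: "\<sigma> powr (1 / q) * norm (f x) = (A * \<sigma>) powr (1 / q)"
    using assms \<open>\<sigma> \<ge> 0\<close> by (simp add: A_def powr_mult powr_powr)
  \<comment> \<open>One limit covers both bounds: \<open>B = 0\<close> for the lower and the bound
    on the near part for the upper one. The term \<open>q * s * B\<close> tends to 0, and
    \<open>s * q\<close> cancels for \<open>s > 0\<close>.\<close>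
  have lim: "((\<lambda>s. ennreal ((q * s * (B + A * (\<sigma> * (R powr (- s * q) / (s * q))))) powr (1 / q)))
      \<longlongrightarrow> ennreal (\<sigma> powr (1 / q) * norm (f x))) (at_right 0)" if "B \<ge> 0" for B
  proof (subst target, intro tendsto_ennrealI tendsto_powr')
    have "((\<lambda>s. q * s * B + A * \<sigma> * R powr (- s * q)) \<longlongrightarrow> q * 0 * B + A * \<sigma> * 1) (at_right 0)"
      by (intro tendsto_intros lim_R)
    moreover have "\<forall>\<^sub>F s in at_right 0. q * s * B + A * \<sigma> * R powr (- s * q) =
        q * s * (B + A * (\<sigma> * (R powr (- s * q) / (s * q))))"
      using eventually_at_right_less[of 0]
      by eventually_elim (use assms in \<open>simp add: field_simps\<close>)
    ultimately show "((\<lambda>s. q * s * (B + A * (\<sigma> * (R powr (- s * q) / (s * q))))) \<longlongrightarrow> A * \<sigma>) (at_right 0)"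
      by (simp add: tendsto_cong)
    have "\<forall>\<^sub>F s in at_right 0. 0 \<le> q * s * (B + A * (\<sigma> * (R powr (- s * q) / (s * q))))"
      using eventually_at_right_less[of 0]
      by eventually_elim (use assms that \<open>A \<ge> 0\<close> \<open>\<sigma> \<ge> 0\<close> in simp)
    \<comment> \<open>The base tends to 0 when \<open>f x = 0\<close>, so continuity of the power
      comes from the positive exponent and the eventually nonnegative base.\<close>
    then show "A * \<sigma> \<noteq> 0 \<or> 0 < 1 / q \<and>
        (\<forall>\<^sub>F s in at_right 0. 0 \<le> q * s * (B + A * (\<sigma> * (R powr (- s * q) / (s * q)))))"
      using assms(1) by simp
  qed auto
  have small: "\<forall>\<^sub>F s in at_right 0. 0 < s \<and> s < \<eta> / 2"
    using assms(2) by (intro eventually_at_rightI[of 0 "\<eta> / 2"]) auto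
  show ?thesis
    unfolding \<sigma>_def[symmetric]
  proof (rule tendsto_sandwich[OF _ _ lim lim])
    \<comment> \<open>The summand \<open>0\<close> is kept so that the expression is literally the
      instance \<open>B = 0\<close> of \<open>lim\<close>; \<open>ord_eq_le_trans\<close> removes it
      before \<open>lower\<close> is applied.\<close>
    show "\<forall>\<^sub>F s in at_right 0. ennreal ((q * s * (0 + A * (\<sigma> * (R powr (- s * q) / (s * q))))) powr (1 / q))
        \<le> ennreal ((q * s) powr (1 / q)) * frac_D s q f x"
      using small
    proof eventually_elim
      case (elim s)
      have nonneg: "0 \<le> 0 + A * (\<sigma> * (R powr (- s * q) / (s * q)))"
        using elim assms \<open>A \<ge> 0\<close> \<open>K \<ge> 0\<close> \<open>\<sigma> \<ge> 0\<close> \<open>c > 0\<close> by simp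
      show ?case
        unfolding frac_D scale[OF conjunct1[OF elim] nonneg, symmetric]
        by (intro mult_left_mono epowr_mono ord_eq_le_trans[OF _ lower]) (use elim assms in auto)
    qed
    show "\<forall>\<^sub>F s in at_right 0. ennreal ((q * s) powr (1 / q)) * frac_D s q f x \<le>
        ennreal ((q * s * (K * (\<sigma> * (R powr c / c)) + A * (\<sigma> * (R powr (- s * q) / (s * q))))) powr (1 / q))"
      using small
    proof eventually_elim
      case (elim s)
      have nonneg: "0 \<le> K * (\<sigma> * (R powr c / c)) + A * (\<sigma> * (R powr (- s * q) / (s * q)))"
        using elim assms \<open>A \<ge> 0\<close> \<open>K \<ge> 0\<close> \<open>\<sigma> \<ge> 0\<close> \<open>c > 0\<close> by simp
      show ?case
        unfolding frac_D scale[OF conjunct1[OF elim] nonneg, symmetric]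
        by (intro mult_left_mono epowr_mono upper) (use elim assms in auto)
    qed
  qed (use \<open>K \<ge> 0\<close> \<open>\<sigma> \<ge> 0\<close> \<open>c > 0\<close> in auto)
qed

end
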